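(* Let $X$ be a separable infinite dimensional Banach space over $\mathbb{K}$ and let $T$ be a bounded linear operator on $X$ such that $\lim_{n\to\infty}\|T^n\|^{1/n}=0$. Then $I+T$ is not $\mathfrak{u}$-frequently hypercyclic. In particular, $I+T$ is not frequently hypercyclic.
   Context: $\mathbb{K}$ denotes either $\mathbb{R}$ or $\mathbb{C}$; $\mathbb{Z}_+$ is the set of non-negative integers, $\mathbb{N}$ the set of positive integers; $I$ is the identity operator. For $A\subseteq\mathbb{Z}_+$, the lower and upper densities are $\underline{d}(A)=\liminf_{n\to\infty}\frac{|\{m\in A:m\leq n\}|}{n}$ and $\overline{d}(A)=\limsup_{n\to\infty}\frac{|\{m\in A:m\leq n\}|}{n}$. Let $S$ be a continuous linear operator on a topological vector space $X$. A vector $x\in X$ is frequently hypercyclic (respectively $\mathfrak{u}$-frequently hypercyclic) for $S$ if for every non-empty open $U\subseteq X$ the set $\{n\in\mathbb{N}:S^nx\in U\}$ has positive lower (respectively positive upper) density. The operator $S$ is called frequently hypercyclic (respectively $\mathfrak{u}$-frequently hypercyclic) if it has a frequently hypercyclic (respectively $\mathfrak{u}$-frequently hypercyclic) vector. *)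

theory Defs
  imports "HOL-Analysis.Analysis"
begin

text \<open>The scalar fields: up to an isometric isomorphism of normed fields over the reals, a type
  of this class is the field of real numbers (range \<open>\<real>\<close>) or the field of complex numbers
  (range \<open>UNIV\<close>).\<close>

class real_or_complex = real_normed_field +
  assumes real_or_complex_iso:
    "\<exists>\<phi> :: 'a \<Rightarrow> complex.
       (\<forall>x y. \<phi> (x + y) = \<phi> x + \<phi> y) \<and> (\<forall>x y. \<phi> (x * y) = \<phi> x * \<phi> y) \<and>
       (\<forall>r x. \<phi> (scaleR r x) = scaleR r (\<phi> x)) \<and> \<phi> 1 = 1 \<and>
       (\<forall>x. cmod (\<phi> x) = norm x) \<and> (range \<phi> = \<real> \<or> range \<phi> = UNIV)"

instance real :: real_or_complex
proof
  have "range complex_of_real = \<real>"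
    by (auto simp: Reals_def)
  then show "\<exists>\<phi> :: real \<Rightarrow> complex.
       (\<forall>x y. \<phi> (x + y) = \<phi> x + \<phi> y) \<and> (\<forall>x y. \<phi> (x * y) = \<phi> x * \<phi> y) \<and>
       (\<forall>r x. \<phi> (scaleR r x) = scaleR r (\<phi> x)) \<and> \<phi> 1 = 1 \<and>
       (\<forall>x. cmod (\<phi> x) = norm x) \<and> (range \<phi> = \<real> \<or> range \<phi> = UNIV)"
    by (intro exI[of _ complex_of_real]) (simp add: scaleR_conv_of_real)
qed

instance complex :: real_or_complex
  by standard (intro exI[of _ "\<lambda>x. x"], simp)

text \<open>A normed space over \<open>'k\<close>, on a type that already carries the norm and the underlying real
  scalar multiplication. With \<open>'x\<close> in class \<open>banach\<close> this is a Banach space over \<open>'k\<close>, since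
  completeness only depends on the norm.\<close>

locale normed_space_over = vector_space smul
  for smul :: "'k::real_or_complex \<Rightarrow> 'x::real_normed_vector \<Rightarrow> 'x" +
  assumes scale_of_real: "smul (of_real r) x = scaleR r x"
    and norm_scale: "norm (smul c x) = norm c * norm x"

lemma normed_space_over_scaleR:
  "normed_space_over (scaleR :: real \<Rightarrow> 'x \<Rightarrow> 'x::real_normed_vector)"
  by unfold_locales (simp_all add: scaleR_add_right scaleR_add_left)

lemma normed_space_over_times:
  "normed_space_over (times :: 'k \<Rightarrow> 'k \<Rightarrow> 'k::real_or_complex)"
  by unfold_locales (simp_all add: algebra_simps norm_mult scaleR_conv_of_real)

definition infinite_dimensional ::
    "('k::field \<Rightarrow> 'x::ab_group_add \<Rightarrow> 'x) \<Rightarrow> bool" where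
  "infinite_dimensional smul \<longleftrightarrow> \<not> (\<exists>B. finite_dimensional_vector_space smul B)"

text \<open>The densities are extended reals so that \<open>liminf\<close> and \<open>limsup\<close> always exist; the term for
  \<open>n = 0\<close> is irrelevant.\<close>

definition lower_density :: "nat set \<Rightarrow> ereal" where
  "lower_density A = liminf (\<lambda>n. ereal (real (card {m \<in> A. m \<le> n}) / real n))"

definition upper_density :: "nat set \<Rightarrow> ereal" where
  "upper_density A = limsup (\<lambda>n. ereal (real (card {m \<in> A. m \<le> n}) / real n))"

text \<open>The remaining notions only involve the topology and the iterates of the map, so they are
  stated for an arbitrary self-map of a topological space.\<close>

definition frequently_hypercyclic_vector ::
    "('x::topological_space \<Rightarrow> 'x) \<Rightarrow> 'x \<Rightarrow> bool" where
  "frequently_hypercyclic_vector S x \<longleftrightarrow>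
     (\<forall>U. open U \<and> U \<noteq> {} \<longrightarrow> lower_density {n. n \<ge> 1 \<and> (S ^^ n) x \<in> U} > 0)"

definition u_frequently_hypercyclic_vector ::
    "('x::topological_space \<Rightarrow> 'x) \<Rightarrow> 'x \<Rightarrow> bool" where
  "u_frequently_hypercyclic_vector S x \<longleftrightarrow>
     (\<forall>U. open U \<and> U \<noteq> {} \<longrightarrow> upper_density {n. n \<ge> 1 \<and> (S ^^ n) x \<in> U} > 0)"

definition frequently_hypercyclic :: "('x::topological_space \<Rightarrow> 'x) \<Rightarrow> bool" where
  "frequently_hypercyclic S \<longleftrightarrow> (\<exists>x. frequently_hypercyclic_vector S x)"

definition u_frequently_hypercyclic :: "('x::topological_space \<Rightarrow> 'x) \<Rightarrow> bool" where
  "u_frequently_hypercyclic S \<longleftrightarrow> (\<exists>x. u_frequently_hypercyclic_vector S x)"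

end

theory Submission
  imports Defs "HOL-Complex_Analysis.Conformal_Mappings" "HOL-Real_Asymp.Real_Asymp"
begin

text \<open>Write \<open>S\<close> for the operator \<open>\<lambda>x. x + T x\<close>, suppose \<open>T \<noteq> 0\<close>, and fix a bounded real-linear
  functional \<open>g\<close> with \<open>g \<circ> T \<noteq> 0\<close> (Hahn-Banach, \<open>hahn_banach_positive_functional\<close>). For a suitable
  \<open>c > 0\<close> the set \<open>U\<close> of all \<open>y\<close> with \<open>\<bar>g y\<bar> < 1\<close> and \<open>g (T y) > c\<close> is open and nonempty. No
  orbit of \<open>S\<close> visits \<open>U\<close> with positive upper density (\<open>upper_density_slab_hits\<close>), and this
  refutes both forms of frequent hypercyclicity. For \<open>T = 0\<close> all orbits are constant.

  To bound the visits to \<open>U\<close>, fix \<open>x\<close> and consider the real sequences \<open>f n = g ((S ^^ n) x)\<close> and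
  \<open>h n = g (T ((S ^^ n) x))\<close>, so that \<open>h n = f (Suc n) - f n\<close>. A visit to \<open>U\<close> at time \<open>n\<close> means that
  \<open>f n\<close> lies in an interval of length \<open>2\<close> and that \<open>f\<close> is about to grow by more than \<open>c\<close>. As \<open>f\<close>
  has to return to the interval, it must decrease between any two visits that are at least \<open>2 / c\<close>
  visits apart: up to a constant factor and an additive constant, the number of visits is bounded by
  the number of sign changes of \<open>h\<close>.

  By the binomial theorem, \<open>h n\<close> is the sum over \<open>k\<close> of \<open>(n choose k) * a k\<close> with
  \<open>a k = g (T ((T ^^ k) x))\<close>, and the assumption on \<open>T\<close> says that \<open>a k\<close> decays faster than every
  geometric sequence. Replacing the integer \<open>n\<close> in the binomial coefficients by a complex variable
  and truncating the sum at \<open>N\<close> produces a polynomial that interpolates \<open>h\<close> on \<open>{0..N}\<close>, so each sign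
  change of \<open>h\<close> up to \<open>N\<close> yields a zero of it. Its modulus is \<open>exp (o(N))\<close> on discs of radius
  \<open>O(N)\<close> (\<open>norm_newton_poly_le\<close>), while its value at a fixed \<open>n\<^sub>0\<close> with \<open>h n\<^sub>0 \<noteq> 0\<close> does not depend
  on \<open>N \<ge> n\<^sub>0\<close>. As in Jensen's formula (\<open>norm_poly_le_zeros\<close>), such a polynomial has only
  \<open>o(N)\<close> zeros in \<open>{0..N}\<close>
  (\<open>newton_poly_few_zeros\<close>).\<close>

section \<open>Bounded functionals from minimal sublinear functions\<close>

definition sublinear :: "('a::real_vector \<Rightarrow> real) \<Rightarrow> bool" where
  "sublinear q \<longleftrightarrow> (\<forall>x y. q (x + y) \<le> q x + q y) \<and> (\<forall>t\<ge>0. \<forall>x. q (t *\<^sub>R x) = t * q x)"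

lemma sublinear_add: "sublinear q \<Longrightarrow> q (x + y) \<le> q x + q y"
  by (simp add: sublinear_def)

lemma sublinear_scale: "sublinear q \<Longrightarrow> t \<ge> 0 \<Longrightarrow> q (t *\<^sub>R x) = t * q x"
  by (simp add: sublinear_def)

lemma sublinear_zero: "sublinear q \<Longrightarrow> q 0 = 0"
  using sublinear_scale[of q 0 0] by simp

lemma sublinear_minus: "sublinear q \<Longrightarrow> - q (- x) \<le> q x"
  using sublinear_add[of q x "- x"] sublinear_zero[of q] by simp

lemma sublinear_norm: "sublinear norm"
  by (auto simp: sublinear_def norm_triangle_ineq)

lemma sublinearI:
  assumes add: "\<And>x y. q (x + y) \<le> q x + q y"
    and scale: "\<And>t x. t > 0 \<Longrightarrow> q (t *\<^sub>R x) \<le> t * q x" and zero: "q 0 = 0"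
  shows "sublinear q"
  unfolding sublinear_def
proof (intro conjI allI impI)
  fix t :: real and x assume "t \<ge> 0"
  show "q (t *\<^sub>R x) = t * q x"
  proof (cases "t = 0")
    case False
    with \<open>t \<ge> 0\<close> have "t > 0" by simp
    then have "q x \<le> (1 / t) * q (t *\<^sub>R x)"
      using scale[of "1 / t" "t *\<^sub>R x"] by simp
    with \<open>t > 0\<close> have "t * q x \<le> q (t *\<^sub>R x)" by (simp add: field_simps)
    with scale[OF \<open>t > 0\<close>, of x] show ?thesis by simp
  qed (simp add: zero)
qed (rule add)

text \<open>Tilting lowers a sublinear \<open>q\<close> as far as sublinearity permits while making it linear along the
  line through \<open>y\<close>: \<open>tilt q y\<close> is below \<open>q\<close>, but takes the value \<open>- q y\<close>, the smallest possible
  one, at \<open>- y\<close>.\<close>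

definition tilt :: "('a::real_vector \<Rightarrow> real) \<Rightarrow> 'a \<Rightarrow> 'a \<Rightarrow> real" where
  "tilt q y x = (INF t\<in>{0..}. q (x + t *\<^sub>R y) - t * q y)"

lemma bdd_below_tilt:
  assumes "sublinear q"
  shows "bdd_below ((\<lambda>t. q (x + t *\<^sub>R y) - t * q y) ` {0..})"
proof (rule bdd_belowI2)
  fix t :: real assume "t \<in> {0..}"
  then show "- q (- x) \<le> q (x + t *\<^sub>R y) - t * q y"
    using sublinear_add[OF assms, of "x + t *\<^sub>R y" "- x"] sublinear_scale[OF assms, of t y] by simp
qed

lemma tilt_le:
  assumes "sublinear q" "t \<ge> 0"
  shows "tilt q y x \<le> q (x + t *\<^sub>R y) - t * q y"
  unfolding tilt_def using assms by (intro cINF_lower bdd_below_tilt) auto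

lemma tilt_ge:
  assumes "\<And>t. t \<ge> 0 \<Longrightarrow> b \<le> q (x + t *\<^sub>R y) - t * q y"
  shows "b \<le> tilt q y x"
  unfolding tilt_def using assms by (intro cINF_greatest) auto

lemma sublinear_tilt:
  assumes q: "sublinear q"
  shows "sublinear (tilt q y)"
proof (rule sublinearI)
  fix x x' :: 'a
  have *: "tilt q y (x + x') \<le> (q (x + s *\<^sub>R y) - s * q y) + (q (x' + t *\<^sub>R y) - t * q y)"
    if "s \<ge> 0" "t \<ge> 0" for s t
    using tilt_le[OF q, of "s + t" y "x + x'"] that
      sublinear_add[OF q, of "x + s *\<^sub>R y" "x' + t *\<^sub>R y"]
    by (simp add: algebra_simps)
  have "tilt q y (x + x') - (q (x + s *\<^sub>R y) - s * q y) \<le> tilt q y x'" if "s \<ge> 0" for s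
    by (rule tilt_ge) (use *[OF that] in \<open>simp add: algebra_simps\<close>)
  then have "tilt q y (x + x') - tilt q y x' \<le> tilt q y x"
    by (intro tilt_ge) (simp add: algebra_simps)
  then show "tilt q y (x + x') \<le> tilt q y x + tilt q y x'" by simp
next
  fix r :: real and x :: 'a assume "r > 0"
  have "tilt q y (r *\<^sub>R x) / r \<le> tilt q y x"
  proof (rule tilt_ge)
    fix t :: real assume "t \<ge> 0"
    then have "tilt q y (r *\<^sub>R x) \<le> q (r *\<^sub>R (x + t *\<^sub>R y)) - r * t * q y"
      using tilt_le[OF q, of "r * t" y "r *\<^sub>R x"] \<open>r > 0\<close> by (simp add: scaleR_add_right)
    also have "\<dots> = r * (q (x + t *\<^sub>R y) - t * q y)"
      using \<open>r > 0\<close> by (subst sublinear_scale[OF q]) (simp_all add: algebra_simps)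
    finally show "tilt q y (r *\<^sub>R x) / r \<le> q (x + t *\<^sub>R y) - t * q y"
      using \<open>r > 0\<close> by (simp add: field_simps)
  qed
  then show "tilt q y (r *\<^sub>R x) \<le> r * tilt q y x" using \<open>r > 0\<close> by (simp add: field_simps)
next
  have "tilt q y 0 \<le> 0"
    using tilt_le[OF q, of 0 y 0] sublinear_zero[OF q] by simp
  moreover have "0 \<le> tilt q y 0"
    by (rule tilt_ge) (simp add: sublinear_scale[OF q])
  ultimately show "tilt q y 0 = 0" by simp
qed

lemma tilt_le_self: "sublinear q \<Longrightarrow> tilt q y x \<le> q x"
  using tilt_le[of q 0 y x] by simp

lemma tilt_minus_self: "sublinear q \<Longrightarrow> tilt q y (- y) \<le> - q y"
  using tilt_le[of q 1 y "- y"] by (simp add: sublinear_zero)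

text \<open>A minimal \<open>q\<close> coincides with all its tilts \<open>tilt q y\<close>. Comparing with the term \<open>t = 1\<close> of the
  infimum gives superadditivity, and a function that is both subadditive and superadditive is
  additive.\<close>

lemma minimal_sublinear_linear:
  assumes q: "sublinear q"
    and minimal: "\<And>q'. sublinear q' \<Longrightarrow> (\<And>x. q' x \<le> q x) \<Longrightarrow> q' = q"
  shows "linear q"
proof (rule linearI)
  have "tilt q y = q" for y
    using q by (intro minimal sublinear_tilt tilt_le_self)
  then have "q x + q y \<le> q (x + y)" for x y
    using tilt_le[OF q, of 1 y x] by simp
  then show add: "q (x + y) = q x + q y" for x y
    using sublinear_add[OF q, of x y] by (simp add: order_antisym)
  then have minus: "q (- x) = - q x" for x
    using add[of x "- x"] sublinear_zero[OF q] by simp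
  show "q (r *\<^sub>R x) = r *\<^sub>R q x" for r x
    using sublinear_scale[OF q, of r x] sublinear_scale[OF q, of "- r" x] minus[of "r *\<^sub>R x"]
    by (cases "r \<ge> 0") auto
qed

text \<open>Zorn's lemma applies because the pointwise infimum of a chain of sublinear functions below \<open>p\<close>
  is finite, being bounded below by \<open>- p (- x)\<close>, and is again sublinear: two members of the chain
  can be replaced by the smaller of them.\<close>

lemma minimal_sublinear_exists:
  assumes p: "sublinear p"
  obtains q where "sublinear q" "\<And>x. q x \<le> p x"
    "\<And>q'. sublinear q' \<Longrightarrow> (\<And>x. q' x \<le> q x) \<Longrightarrow> q' = q"
proof -
  define Q where "Q = {q. sublinear q \<and> q \<le> p}"
  have "\<exists>m\<in>Q. \<forall>q\<in>Q. m \<ge> q \<longrightarrow> q = m"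
  proof (rule predicate_Zorn)
    show "partial_order_on Q (relation_of (\<ge>) Q)"
      by (rule partial_order_on_relation_ofI) auto
  next
    fix C assume C: "C \<in> Chains (relation_of (\<ge>) Q)"
    then have chain: "q \<le> q' \<or> q' \<le> q" if "q \<in> C" "q' \<in> C" for q q'
      using that by (auto simp: Chains_def relation_of_def)
    show "\<exists>u\<in>Q. \<forall>q\<in>C. u \<le> q"
    proof (cases "C = {}")
      case True
      then show ?thesis using p by (intro bexI[of _ p]) (auto simp: Q_def)
    next
      case False
      define u where "u x = (INF q\<in>C. q x)" for x
      have CQ: "sublinear q" "q \<le> p" if "q \<in> C" for q
        using C that by (auto simp: Chains_def relation_of_def Q_def)
      have "- p (- x) \<le> q x" if "q \<in> C" for q x
        using sublinear_minus[OF CQ(1)[OF that], of x] le_funD[OF CQ(2)[OF that], of "- x"] by simp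
      then have bdd: "bdd_below ((\<lambda>q. q x) ` C)" for x
        by (intro bdd_belowI2)
      have u_le: "u x \<le> q x" if "q \<in> C" for q x
        unfolding u_def using that by (intro cINF_lower bdd)
      have u_ge: "b \<le> u x" if "\<And>q. q \<in> C \<Longrightarrow> b \<le> q x" for b x
        unfolding u_def using that False by (intro cINF_greatest)
      have "sublinear u"
      proof (rule sublinearI)
        fix x y
        have *: "u (x + y) \<le> q x + q' y" if "q \<in> C" "q' \<in> C" for q q'
        proof -
          \<comment> \<open>Subadditivity needs a single function to evaluate at both points.\<close>
          have "\<exists>q''\<in>C. q'' \<le> q \<and> q'' \<le> q'" using chain[OF that] that by auto
          then obtain q'' where q'': "q'' \<in> C" "q'' \<le> q" "q'' \<le> q'" by blast
          have "u (x + y) \<le> q'' x + q'' y"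
            using u_le[OF q''(1), of "x + y"] sublinear_add[OF CQ(1)[OF q''(1)], of x y] by simp
          then show ?thesis using le_funD[OF q''(2), of x] le_funD[OF q''(3), of y] by simp
        qed
        have "u (x + y) - q x \<le> u y" if "q \<in> C" for q
          by (rule u_ge) (use *[OF that] in \<open>simp add: algebra_simps\<close>)
        then have "u (x + y) - u y \<le> u x"
          by (intro u_ge) (simp add: algebra_simps)
        then show "u (x + y) \<le> u x + u y" by simp
      next
        fix t :: real and x assume "t > 0"
        have "u (t *\<^sub>R x) / t \<le> u x"
        proof (rule u_ge)
          fix q assume "q \<in> C"
          then show "u (t *\<^sub>R x) / t \<le> q x"
            using u_le[of q "t *\<^sub>R x"] sublinear_scale[OF CQ(1), of q t x] \<open>t > 0\<close>
            by (simp add: field_simps)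
        qed
        then show "u (t *\<^sub>R x) \<le> t * u x" using \<open>t > 0\<close> by (simp add: field_simps)
      next
        show "u 0 = 0" using False CQ(1) by (simp add: u_def sublinear_zero)
      qed
      moreover have "u \<le> p"
        using False u_le CQ(2) by (meson all_not_in_conv le_funI order_trans le_funD)
      ultimately show ?thesis using u_le by (intro bexI[of _ u]) (auto simp: Q_def le_fun_def)
    qed
  qed
  then obtain q where q: "q \<in> Q" and min: "\<And>q'. q' \<in> Q \<Longrightarrow> q' \<le> q \<Longrightarrow> q' = q" by blast
  show thesis
  proof (rule that)
    show "sublinear q" "\<And>x. q x \<le> p x" using q by (auto simp: Q_def le_fun_def)
    then show "q' = q" if "sublinear q'" "\<And>x. q' x \<le> q x" for q'
      using that by (intro min) (auto simp: Q_def le_fun_def intro: order_trans)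
  qed
qed

text \<open>The Hahn-Banach theorem in the form that bounded functionals separate points from \<open>0\<close>. Starting
  the descent to a minimal sublinear function at \<open>tilt norm y\<close> rather than at the norm
  forces \<open>g (- y) \<le> - norm y\<close>.\<close>

lemma hahn_banach_positive_functional:
  fixes y :: "'a::real_normed_vector"
  assumes "y \<noteq> 0"
  obtains g :: "'a \<Rightarrow> real" where "bounded_linear g" "g y > 0"
proof -
  obtain g where g: "sublinear g" "\<And>x. g x \<le> tilt norm y x" and "linear g"
    using minimal_sublinear_exists[OF sublinear_tilt[OF sublinear_norm]]
      minimal_sublinear_linear by metis
  interpret linear g by fact
  have le: "g x \<le> norm x" for x
    using g(2)[of x] tilt_le_self[OF sublinear_norm, of y x] by simp
  have "norm (g x) \<le> norm x * 1" for x
    using le[of x] le[of "- x"] by (simp add: neg)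
  then have "bounded_linear g"
    by (intro bounded_linear_intro[OF add scale])
  moreover have "g y > 0"
    using g(2)[of "- y"] tilt_minus_self[OF sublinear_norm, of y] assms
    by (simp add: neg) (smt (verit) zero_less_norm_iff)
  ultimately show thesis by (rule that)
qed

section \<open>Newton polynomials and their zeros\<close>

definition newton_poly :: "(nat \<Rightarrow> 'a::field_char_0) \<Rightarrow> nat \<Rightarrow> 'a poly" where
  "newton_poly a N = (\<Sum>k\<le>N. smult (a k / fact k) (\<Prod>i<k. [:- of_nat i, 1:]))"

lemma poly_newton_poly: "poly (newton_poly a N) z = (\<Sum>k\<le>N. a k * (z gchoose k))"
  unfolding newton_poly_def poly_sum
  by (intro sum.cong) (simp_all add: poly_prod gbinomial_prod_rev atLeast0LessThan)

lemma poly_newton_poly_of_real: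
  "poly (newton_poly (\<lambda>k. of_real (a k)) N) (of_real t) =
    (of_real (poly (newton_poly a N) t) :: 'a::{real_field,field_char_0})"
  by (simp add: poly_newton_poly gbinomial_prod_rev)

text \<open>If every row of an array is obtained from the previous one by adding to each entry its right
  neighbour, then the first row consists of the forward differences at \<open>0\<close> of the first column,
  and this is Newton's interpolation formula.\<close>

lemma newton_interpolation:
  fixes F :: "nat \<Rightarrow> nat \<Rightarrow> 'a::field_char_0"
  assumes diff: "\<And>n j. F (Suc n) j = F n j + F n (Suc j)" and "n \<le> N"
  shows "poly (newton_poly (F 0) N) (of_nat n) = F n 0"
proof -
  have "F n j = (\<Sum>k\<le>n. of_nat (n choose k) * F 0 (j + k))" for j
  proof (induction n arbitrary: j)
    case (Suc n)
    have "(\<Sum>k\<le>Suc n. of_nat (Suc n choose k) * F 0 (j + k)) =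
        F 0 j + (\<Sum>k\<le>n. of_nat (n choose Suc k) * F 0 (j + Suc k))
          + (\<Sum>k\<le>n. of_nat (n choose k) * F 0 (Suc j + k))"
      by (subst sum.atMost_Suc_shift) (simp add: sum.distrib algebra_simps)
    also have "F 0 j + (\<Sum>k\<le>n. of_nat (n choose Suc k) * F 0 (j + Suc k)) =
        (\<Sum>k\<le>Suc n. of_nat (n choose k) * F 0 (j + k))"
      by (subst sum.atMost_Suc_shift) simp
    finally show ?case
      using Suc.IH[of j] Suc.IH[of "Suc j"] diff[of n j] by simp
  qed simp
  from this[of 0] have "F n 0 = (\<Sum>k\<le>n. of_nat (n choose k) * F 0 k)" by simp
  also have "\<dots> = (\<Sum>k\<le>N. of_nat (n choose k) * F 0 k)"
    using \<open>n \<le> N\<close> by (intro sum.mono_neutral_left) auto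
  finally show ?thesis
    by (simp add: poly_newton_poly binomial_gbinomial mult.commute)
qed

lemma norm_gbinomial_le:
  fixes z :: "'a::{real_normed_field,field_char_0}"
  assumes "norm z \<le> 5 * real N" "k \<le> N"
  shows "norm (z gchoose k) \<le> (6 * real N) ^ k / fact k"
proof -
  have "norm (z - of_nat i) \<le> 6 * real N" if "i < k" for i
    using norm_triangle_ineq4[of z "of_nat i"] assms that by simp
  then have "(\<Prod>i<k. norm (z - of_nat i)) \<le> (\<Prod>i<k. 6 * real N)"
    by (intro prod_mono) auto
  then show ?thesis
    by (simp add: gbinomial_prod_rev norm_divide prod_norm atLeast0LessThan divide_right_mono)
qed

lemma sum_power_div_fact_le_exp:
  fixes x :: real
  assumes "x \<ge> 0"
  shows "(\<Sum>k\<le>N. x ^ k / fact k) \<le> exp x"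
proof -
  have "(\<Sum>k\<in>{..N}. x ^ k /\<^sub>R fact k) \<le> (\<Sum>k. x ^ k /\<^sub>R fact k)"
    using assms by (intro sum_le_suminf summable_exp_generic) auto
  then show ?thesis by (simp add: exp_def divide_inverse mult.commute)
qed

lemma norm_newton_poly_le:
  fixes z :: "'a::{real_normed_field,field_char_0}"
  assumes a: "\<And>k. norm (a k) \<le> C * \<eta> ^ k" and "\<eta> > 0" and z: "norm z \<le> 5 * real N"
  shows "norm (poly (newton_poly a N) z) \<le> C * exp (6 * \<eta> * real N)"
proof -
  have "C \<ge> 0" using order_trans[OF norm_ge_zero a[of 0]] by simp
  have "norm (poly (newton_poly a N) z) \<le> (\<Sum>k\<le>N. norm (a k * (z gchoose k)))"
    unfolding poly_newton_poly by (rule norm_sum)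
  also have "\<dots> \<le> (\<Sum>k\<le>N. (C * \<eta> ^ k) * ((6 * real N) ^ k / fact k))"
    unfolding norm_mult using \<open>C \<ge> 0\<close> \<open>\<eta> > 0\<close>
    by (intro sum_mono mult_mono a norm_gbinomial_le z) auto
  also have "\<dots> = C * (\<Sum>k\<le>N. (6 * \<eta> * real N) ^ k / fact k)"
    by (simp add: sum_distrib_left power_mult_distrib algebra_simps)
  also have "\<dots> \<le> C * exp (6 * \<eta> * real N)"
    using \<open>C \<ge> 0\<close> \<open>\<eta> > 0\<close> by (intro mult_left_mono sum_power_div_fact_le_exp) auto
  finally show ?thesis .
qed

lemma prod_linear_factors_dvd:
  fixes p :: "'a::idom poly"
  assumes "finite Z" "\<And>\<zeta>. \<zeta> \<in> Z \<Longrightarrow> poly p \<zeta> = 0"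
  shows "(\<Prod>\<zeta>\<in>Z. [:- \<zeta>, 1:]) dvd p"
  using assms
proof (induction Z arbitrary: p rule: finite_induct)
  case (insert \<zeta> Z)
  then obtain q where q: "p = [:- \<zeta>, 1:] * q"
    using poly_eq_0_iff_dvd[of p \<zeta>] by (auto elim: dvdE)
  have "poly q \<xi> = 0" if "\<xi> \<in> Z" for \<xi>
    using insert.prems[of \<xi>] insert.hyps that by (auto simp: q)
  then have "(\<Prod>\<zeta>\<in>Z. [:- \<zeta>, 1:]) dvd q" by (rule insert.IH)
  then have "[:- \<zeta>, 1:] * (\<Prod>\<zeta>\<in>Z. [:- \<zeta>, 1:]) dvd p"
    unfolding q by (rule mult_dvd_mono[OF dvd_refl])
  then show ?case by (simp only: prod.insert[OF insert.hyps])
qed simp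

text \<open>A quantitative form of the fact that many zeros make a function small. Divide out the linear
  factors of the zeros: each has modulus at least \<open>4 * R\<close> on the circle of radius \<open>5 * R\<close> and at
  most \<open>2 * R\<close> at \<open>w\<close>, and the quotient obeys the maximum principle.\<close>

lemma norm_poly_le_zeros:
  fixes p :: "complex poly"
  assumes "R > 0" and "finite Z" and Z: "\<And>\<zeta>. \<zeta> \<in> Z \<Longrightarrow> cmod \<zeta> \<le> R \<and> poly p \<zeta> = 0"
    and M: "\<And>z. cmod z = 5 * R \<Longrightarrow> cmod (poly p z) \<le> M" and w: "cmod w \<le> R"
  shows "cmod (poly p w) \<le> M / 2 ^ card Z"
proof -
  obtain q where q: "p = (\<Prod>\<zeta>\<in>Z. [:- \<zeta>, 1:]) * q"
    using prod_linear_factors_dvd[OF \<open>finite Z\<close>, of p] Z by (auto elim: dvdE)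
  have norm_p: "cmod (poly p z) = (\<Prod>\<zeta>\<in>Z. cmod (z - \<zeta>)) * cmod (poly q z)" for z
  proof -
    have "poly p z = (\<Prod>\<zeta>\<in>Z. z - \<zeta>) * poly q z" by (simp add: q poly_prod)
    then show ?thesis by (simp only: norm_mult prod_norm)
  qed
  have "cmod (poly q w) \<le> M / (4 * R) ^ card Z"
  proof (rule maximum_modulus_frontier[of "poly q" "cball 0 (5 * R)"])
    fix z :: complex assume "z \<in> frontier (cball 0 (5 * R))"
    then have z: "cmod z = 5 * R" using \<open>R > 0\<close> by simp
    have "(\<Prod>\<zeta>\<in>Z. 4 * R) \<le> (\<Prod>\<zeta>\<in>Z. cmod (z - \<zeta>))"
    proof (rule prod_mono)
      fix \<zeta> assume "\<zeta> \<in> Z"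
      then show "0 \<le> 4 * R \<and> 4 * R \<le> cmod (z - \<zeta>)"
        using norm_triangle_ineq2[of z \<zeta>] Z[of \<zeta>] z \<open>R > 0\<close> by auto
    qed
    then have "(4 * R) ^ card Z * cmod (poly q z) \<le> cmod (poly p z)"
      by (auto simp: norm_p intro!: mult_right_mono)
    also have "\<dots> \<le> M" using M z by simp
    finally show "cmod (poly q z) \<le> M / (4 * R) ^ card Z"
      using \<open>R > 0\<close> by (simp add: field_simps)
  qed (use w \<open>R > 0\<close> in \<open>auto intro!: holomorphic_intros continuous_intros\<close>)
  moreover have "(\<Prod>\<zeta>\<in>Z. cmod (w - \<zeta>)) \<le> (\<Prod>\<zeta>\<in>Z. 2 * R)"
  proof (rule prod_mono)
    fix \<zeta> assume "\<zeta> \<in> Z"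
    then show "0 \<le> cmod (w - \<zeta>) \<and> cmod (w - \<zeta>) \<le> 2 * R"
      using norm_triangle_ineq4[of w \<zeta>] Z[of \<zeta>] w by auto
  qed
  ultimately have "cmod (poly p w) \<le> (2 * R) ^ card Z * (M / (4 * R) ^ card Z)"
    unfolding norm_p using \<open>R > 0\<close> by (intro mult_mono) auto
  also have "(4 * R) ^ card Z = (2 * R) ^ card Z * 2 ^ card Z"
    by (simp only: flip: power_mult_distrib) simp
  also have "(2 * R) ^ card Z * (M / ((2 * R) ^ card Z * 2 ^ card Z)) = M / 2 ^ card Z"
    using \<open>R > 0\<close> by simp
  finally show ?thesis .
qed

text \<open>Up to radius \<open>5 * N\<close> the polynomial is at most \<open>C * exp (6 * \<eta> * N)\<close> for every \<open>\<eta> > 0\<close>, where \<open>C\<close>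
  may depend on \<open>\<eta>\<close>. So with more than \<open>\<delta> * N\<close> zeros in \<open>{0..N}\<close> it would be at most \<open>C * exp (6 * \<eta> * N) / 2 powr (\<delta> * N)\<close>
  at the fixed point \<open>n\<^sub>0\<close>. For small \<open>\<eta>\<close> this tends to \<open>0\<close>, whereas the value at \<open>n\<^sub>0\<close> is \<open>v\<close>
  for all large \<open>N\<close>.\<close>

lemma newton_poly_few_zeros:
  fixes a :: "nat \<Rightarrow> real"
  assumes growth: "\<And>\<eta>. \<eta> > 0 \<Longrightarrow> \<exists>C. \<forall>k. \<bar>a k\<bar> \<le> C * \<eta> ^ k"
    and "v \<noteq> 0" and v: "\<And>N. N \<ge> n\<^sub>0 \<Longrightarrow> poly (newton_poly a N) (real n\<^sub>0) = v"
    and "\<delta> > 0"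
  shows "\<forall>\<^sub>F N in sequentially.
    real (card {\<zeta>\<in>{0..real N}. poly (newton_poly a N) \<zeta> = 0}) \<le> \<delta> * real N"
proof -
  \<comment> \<open>This makes \<open>exp (6 * \<eta> * N)\<close> the square root of \<open>2 powr (\<delta> * N)\<close>.\<close>
  define \<eta> where "\<eta> = \<delta> * ln 2 / 12"
  have "\<eta> > 0" using \<open>\<delta> > 0\<close> by (simp add: \<eta>_def)
  then obtain C where C: "\<And>k. \<bar>a k\<bar> \<le> C * \<eta> ^ k" using growth by blast
  have "(\<lambda>N. C * exp (- (6 * \<eta>) * real N)) \<longlonglongrightarrow> 0"
    using \<open>\<eta> > 0\<close> by real_asymp
  then have "\<forall>\<^sub>F N in sequentially. C * exp (- (6 * \<eta>) * real N) < \<bar>v\<bar>"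
    using \<open>v \<noteq> 0\<close> by (intro order_tendstoD(2)) auto
  moreover have "\<forall>\<^sub>F N in sequentially. N \<ge> n\<^sub>0 \<and> N \<ge> 1"
    by (intro eventually_conj eventually_ge_at_top)
  ultimately show ?thesis
  proof eventually_elim
    case (elim N)
    define p where "p = newton_poly (\<lambda>k. complex_of_real (a k)) N"
    define Z where "Z = {\<zeta>\<in>{0..real N}. poly (newton_poly a N) \<zeta> = 0}"
    have "newton_poly a N \<noteq> 0" using v[of N] elim \<open>v \<noteq> 0\<close> by auto
    then have "finite Z" unfolding Z_def by (rule rev_finite_subset[OF poly_roots_finite]) auto
    have p_of_real: "poly p (of_real t) = of_real (poly (newton_poly a N) t)" for t
      unfolding p_def by (rule poly_newton_poly_of_real)
    have "cmod (poly p (of_real (real n\<^sub>0))) \<le> C * exp (6 * \<eta> * real N) / 2 ^ card (complex_of_real ` Z)"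
    proof (rule norm_poly_le_zeros)
      show "cmod (poly p z) \<le> C * exp (6 * \<eta> * real N)" if "cmod z = 5 * real N" for z
        unfolding p_def using C \<open>\<eta> > 0\<close> that by (intro norm_newton_poly_le) auto
      show "cmod \<zeta> \<le> real N \<and> poly p \<zeta> = 0" if "\<zeta> \<in> of_real ` Z" for \<zeta>
        using that by (auto simp: Z_def p_of_real)
    qed (use elim \<open>finite Z\<close> in auto)
    then have bound: "\<bar>v\<bar> \<le> C * exp (6 * \<eta> * real N) / 2 ^ card Z"
      using elim v[of N] by (simp add: p_of_real card_image inj_on_def del: of_real_of_nat_eq)
    have "real (card Z) \<le> \<delta> * real N"
    proof (rule ccontr)
      assume "\<not> real (card Z) \<le> \<delta> * real N"
      then have "exp (12 * \<eta> * real N) \<le> exp (real (card Z) * ln 2)"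
        by (simp add: \<eta>_def)
      also have "\<dots> = 2 ^ card Z" by (simp add: exp_of_nat_mult)
      finally have "C * exp (6 * \<eta> * real N) / 2 ^ card Z
          \<le> C * exp (6 * \<eta> * real N) / exp (12 * \<eta> * real N)"
        using order_trans[OF abs_ge_zero C[of 0]] by (intro divide_left_mono) auto
      also have "\<dots> = C * exp (- (6 * \<eta>) * real N)"
      proof -
        have "exp (6 * \<eta> * real N) / exp (12 * \<eta> * real N) = exp (- (6 * \<eta>) * real N)"
          by (simp add: algebra_simps flip: exp_diff)
        then show ?thesis by (metis times_divide_eq_right)
      qed
      finally show False using bound elim by simp
    qed
    then show ?case by (simp add: Z_def)
  qed
qed

section \<open>Orbits of a quasinilpotent perturbation of the identity\<close>

text \<open>Sort the elements of \<open>A\<close> by the number of points of \<open>Z\<close> to their left. Elements with the same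
  number are not separated by a point of \<open>Z\<close>, so there are at most \<open>K\<close> of them.\<close>

lemma card_le_of_separating_points:
  fixes A :: "nat set" and Z :: "real set"
  assumes "finite A" "finite Z" "K \<ge> 1"
    and sep: "\<And>n m. n \<in> A \<Longrightarrow> m \<in> A \<Longrightarrow> n < m \<Longrightarrow> K \<le> card (A \<inter> {n..<m}) \<Longrightarrow>
      \<exists>\<zeta>\<in>Z. real n < \<zeta> \<and> \<zeta> < real m"
  shows "card A \<le> K * (card Z + 1)"
proof -
  define j where "j n = card {\<zeta>\<in>Z. \<zeta> < real n}" for n :: nat
  have fiber: "card {n\<in>A. j n = i} \<le> K" for i
  proof (rule ccontr)
    define F where "F = {n\<in>A. j n = i}"
    assume "\<not> card {n\<in>A. j n = i} \<le> K"
    then have "K < card F" by (simp add: F_def)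
    have "finite F" using \<open>finite A\<close> by (simp add: F_def)
    have "F \<noteq> {}" using \<open>K < card F\<close> by auto
    note Max = Max_in[OF \<open>finite F\<close> \<open>F \<noteq> {}\<close>] Max_ge[OF \<open>finite F\<close>]
    note Min = Min_in[OF \<open>finite F\<close> \<open>F \<noteq> {}\<close>] Min_le[OF \<open>finite F\<close>]
    have "F - {Max F} \<subseteq> A \<inter> {Min F..<Max F}"
    proof
      fix n assume "n \<in> F - {Max F}"
      then show "n \<in> A \<inter> {Min F..<Max F}"
        using Max(2)[of n] Min(2)[of n] by (auto simp: F_def[symmetric] order_less_le) (simp add: F_def)
    qed
    then have "card (F - {Max F}) \<le> card (A \<inter> {Min F..<Max F})"
      by (intro card_mono) auto
    then have K: "K \<le> card (A \<inter> {Min F..<Max F})"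
      using \<open>K < card F\<close> Max(1) \<open>finite F\<close> by (simp add: card_Diff_singleton)
    then have "Min F < Max F" using \<open>K \<ge> 1\<close> by (cases "Min F < Max F") auto
    then obtain \<zeta> where \<zeta>: "\<zeta> \<in> Z" "real (Min F) < \<zeta>" "\<zeta> < real (Max F)"
      using sep[of "Min F" "Max F"] K Max(1) Min(1) by (auto simp: F_def)
    then have "\<zeta> \<in> {\<zeta>\<in>Z. \<zeta> < real (Max F)} - {\<zeta>\<in>Z. \<zeta> < real (Min F)}"
      and "{\<zeta>\<in>Z. \<zeta> < real (Min F)} \<subseteq> {\<zeta>\<in>Z. \<zeta> < real (Max F)}"
      by auto
    then have "{\<zeta>\<in>Z. \<zeta> < real (Min F)} \<subset> {\<zeta>\<in>Z. \<zeta> < real (Max F)}" by blast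
    then have "j (Min F) < j (Max F)"
      unfolding j_def using \<open>finite Z\<close> by (intro psubset_card_mono) auto
    then show False using Max(1) Min(1) by (simp add: F_def)
  qed
  have "j n \<le> card Z" for n unfolding j_def using \<open>finite Z\<close> by (intro card_mono) auto
  then have "A = (\<Union>i\<in>{..card Z}. {n\<in>A. j n = i})" by auto
  then have "card A \<le> (\<Sum>i\<le>card Z. card {n\<in>A. j n = i})"
    by (metis card_UN_le finite_atMost)
  also have "\<dots> \<le> (\<Sum>i\<le>card Z. K)" by (intro sum_mono fiber)
  finally show ?thesis by (simp add: mult.commute)
qed

lemma geometric_bound_of_root_tendsto_0:
  fixes b :: "nat \<Rightarrow> real"
  assumes "\<And>k. b k \<ge> 0" and lim: "(\<lambda>k. root k (b k)) \<longlonglongrightarrow> 0" and "\<eta> > 0"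
  shows "\<exists>C. \<forall>k. b k \<le> C * \<eta> ^ k"
proof -
  have "\<forall>\<^sub>F k in sequentially. root k (b k) < \<eta>"
    using order_tendstoD(2)[OF lim \<open>\<eta> > 0\<close>] .
  then have "\<forall>\<^sub>F k in sequentially. b k / \<eta> ^ k \<le> 1"
    using eventually_ge_at_top[of 1]
  proof eventually_elim
    case (elim k)
    have "b k = root k (b k) ^ k" using elim assms(1) by simp
    also have "\<dots> \<le> \<eta> ^ k" using elim assms(1)[of k] by (intro power_mono) auto
    finally show ?case using \<open>\<eta> > 0\<close> by simp
  qed
  then have "Bfun (\<lambda>k. b k / \<eta> ^ k) sequentially"
    using assms(1) \<open>\<eta> > 0\<close> by (intro BfunI[of _ 1]) (auto elim: eventually_mono)
  then obtain C where C: "\<And>k. norm (b k / \<eta> ^ k) \<le> C" by (auto simp: Bseq_def)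
  have "b k \<le> C * \<eta> ^ k" for k
    using C[of k] assms(1)[of k] \<open>\<eta> > 0\<close> by (simp add: divide_le_eq)
  then show ?thesis by blast
qed

lemma upper_density_nonpos:
  assumes "\<And>\<epsilon>. \<epsilon> > 0 \<Longrightarrow> \<forall>\<^sub>F N in sequentially. real (card {m\<in>A. m \<le> N}) \<le> \<epsilon> * real N"
  shows "upper_density A \<le> 0"
proof (rule ereal_le_epsilon2)
  fix \<epsilon> :: real assume "\<epsilon> > 0"
  have "\<forall>\<^sub>F N in sequentially. ereal (real (card {m\<in>A. m \<le> N}) / real N) \<le> 0 + ereal \<epsilon>"
    using assms[OF \<open>\<epsilon> > 0\<close>] eventually_gt_at_top[of 0]
    by eventually_elim (simp add: divide_le_eq)
  then show "upper_density A \<le> 0 + ereal \<epsilon>"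
    unfolding upper_density_def by (rule Limsup_bounded)
qed

lemma upper_density_mono:
  assumes "A \<subseteq> B"
  shows "upper_density A \<le> upper_density B"
  unfolding upper_density_def
proof (intro Limsup_mono always_eventually allI)
  fix n
  have "card {m\<in>A. m \<le> n} \<le> card {m\<in>B. m \<le> n}"
    using assms by (intro card_mono) auto
  then show "ereal (real (card {m\<in>A. m \<le> n}) / real n) \<le> ereal (real (card {m\<in>B. m \<le> n}) / real n)"
    by (simp add: divide_right_mono)
qed

lemma lower_density_le_upper_density: "lower_density A \<le> upper_density A"
  unfolding lower_density_def upper_density_def by (intro Liminf_le_Limsup) simp

lemma bounded_linear_funpow:
  assumes "bounded_linear (T :: 'a::real_normed_vector \<Rightarrow> 'a)"
  shows "bounded_linear (T ^^ k)"
proof (induction k)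
  case (Suc k)
  then show ?case using bounded_linear_compose[OF assms Suc] by (simp add: o_def)
qed (simp add: id_def)

text \<open>The set in question is where the sequence \<open>f n = g ((S ^^ n) x)\<close> lies in \<open>{-1<..<1}\<close> while its
  increment exceeds \<open>c\<close>. Once \<open>K * c \<ge> 2\<close>, the sequence \<open>f\<close> cannot be nondecreasing over a stretch
  that starts and ends in this set and contains \<open>K\<close> increments exceeding \<open>c\<close>; so the
  increment is negative somewhere in between, and its interpolating polynomial has a zero there.
  There are few such zeros, hence few hits.\<close>

lemma upper_density_slab_hits:
  fixes T :: "'x::real_normed_vector \<Rightarrow> 'x" and g :: "'x \<Rightarrow> real"
  assumes T: "bounded_linear T" and qn: "(\<lambda>n. root n (onorm (T ^^ n))) \<longlonglongrightarrow> 0"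
    and g: "bounded_linear g" and "c > 0"
  defines "S \<equiv> \<lambda>y. y + T y"
  shows "upper_density {n. \<bar>g ((S ^^ n) x)\<bar> < 1 \<and> g (T ((S ^^ n) x)) > c} \<le> 0"
    (is "upper_density ?A \<le> 0")
proof (cases "?A = {}")
  case True
  show ?thesis by (rule upper_density_nonpos) (subst True, simp)
next
  case False
  then obtain n\<^sub>0 where n0: "n\<^sub>0 \<in> ?A" by blast
  have S_apply: "S y = y + T y" for y by (simp add: S_def)
  define f where "f n = g ((S ^^ n) x)" for n
  define h where "h n = g (T ((S ^^ n) x))" for n
  define a where "a k = g (T ((T ^^ k) x))" for k
  have gT: "bounded_linear (\<lambda>y. g (T y))" by (rule bounded_linear_compose[OF g T])
  have step: "f (Suc n) = f n + h n" for n
    by (simp add: f_def h_def S_apply linear_add[OF bounded_linear.linear[OF g]])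
  have h_eq: "poly (newton_poly a N) (real n) = h n" if "n \<le> N" for n N
  proof -
    \<comment> \<open>Applying \<open>S\<close> once more adds to \<open>F n j\<close> its neighbour \<open>F n (Suc j)\<close>; row \<open>0\<close> is \<open>a\<close>.\<close>
    define F where "F n j = g (T ((T ^^ j) ((S ^^ n) x)))" for n j
    have F_diff: "F (Suc n) j = F n j + F n (Suc j)" for n j
    proof -
      define y where "y = (S ^^ n) x"
      have "(T ^^ j) ((S ^^ Suc n) x) = (T ^^ j) (y + T y)" by (simp add: S_apply y_def)
      also have "\<dots> = (T ^^ j) y + (T ^^ Suc j) y"
        by (simp add: linear_add[OF bounded_linear.linear[OF bounded_linear_funpow[OF T]]]
            funpow_swap1[of T j y])
      finally show ?thesis
        unfolding F_def y_def[symmetric]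
        by (simp only: linear_add[OF bounded_linear.linear[OF gT]])
    qed
    have "F 0 = a" "F n 0 = h n" by (auto simp: F_def a_def h_def)
    with newton_interpolation[of F n N, OF F_diff that] show ?thesis by (simp only:)
  qed
  have growth: "\<exists>C. \<forall>k. \<bar>a k\<bar> \<le> C * \<eta> ^ k" if "\<eta> > 0" for \<eta>
  proof -
    obtain C where C: "\<And>k. onorm (T ^^ k) \<le> C * \<eta> ^ k"
      using geometric_bound_of_root_tendsto_0[of "\<lambda>k. onorm (T ^^ k)", OF _ qn \<open>\<eta> > 0\<close>]
        onorm_pos_le[OF bounded_linear_funpow[OF T]] by blast
    have "\<bar>a k\<bar> \<le> (onorm (\<lambda>y. g (T y)) * C * norm x) * \<eta> ^ k" for k
    proof -
      have "norm ((T ^^ k) x) \<le> C * \<eta> ^ k * norm x"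
        using onorm[OF bounded_linear_funpow[OF T], of k x] mult_right_mono[OF C[of k], of "norm x"]
        by simp
      then have "onorm (\<lambda>y. g (T y)) * norm ((T ^^ k) x)
          \<le> onorm (\<lambda>y. g (T y)) * (C * \<eta> ^ k * norm x)"
        using onorm_pos_le[OF gT] by (rule mult_left_mono)
      moreover have "\<bar>a k\<bar> \<le> onorm (\<lambda>y. g (T y)) * norm ((T ^^ k) x)"
        using onorm[OF gT, of "(T ^^ k) x"] by (simp add: a_def)
      ultimately show ?thesis by (simp add: mult_ac)
    qed
    then show ?thesis by blast
  qed
  define K where "K = nat \<lceil>2 / c\<rceil>"
  have "K > 0" "2 \<le> c * real K"
  proof -
    show "K > 0" using \<open>c > 0\<close> by (simp add: K_def)
    have "2 / c \<le> real K" unfolding K_def by (rule of_nat_ceiling)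
    then show "2 \<le> c * real K" using \<open>c > 0\<close> by (simp add: pos_divide_le_eq mult.commute)
  qed
  have count: "card {m\<in>?A. m \<le> N} \<le> K * (card {\<zeta>\<in>{0..real N}. poly (newton_poly a N) \<zeta> = 0} + 1)"
    if "N \<ge> n\<^sub>0" for N
  proof (rule card_le_of_separating_points)
    have "newton_poly a N \<noteq> 0" using h_eq[OF that] n0 \<open>c > 0\<close> by (auto simp: h_def)
    then show "finite {\<zeta>\<in>{0..real N}. poly (newton_poly a N) \<zeta> = 0}"
      by (rule rev_finite_subset[OF poly_roots_finite]) auto
  next
    fix n m assume n: "n \<in> {m\<in>?A. m \<le> N}" and m: "m \<in> {m\<in>?A. m \<le> N}" and "n < m"
      and K: "K \<le> card ({m\<in>?A. m \<le> N} \<inter> {n..<m})" (is "_ \<le> card ?B")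
    have "\<exists>l\<in>{n..<m}. h l < 0"
    proof (rule ccontr)
      assume "\<not> (\<exists>l\<in>{n..<m}. h l < 0)"
      then have nonneg: "h l \<ge> 0" if "l \<in> {n..<m}" for l using that by (auto simp: not_less)
      have "2 \<le> (\<Sum>l\<in>?B. c)"
        using order_trans[OF \<open>2 \<le> c * real K\<close> mult_left_mono[of "real K" "real (card ?B)" c]] K \<open>c > 0\<close>
        by (simp add: mult.commute)
      also have "\<dots> \<le> (\<Sum>l\<in>?B. h l)" by (intro sum_mono) (auto simp: h_def)
      also have "\<dots> \<le> (\<Sum>l\<in>{n..<m}. h l)" using nonneg by (intro sum_mono2) auto
      also have "\<dots> = (\<Sum>l\<in>{n..<m}. f (Suc l) - f l)" by (simp add: step)
      also have "\<dots> = f m - f n" using \<open>n < m\<close> by (simp add: sum_Suc_diff')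
      finally show False using n m by (auto simp: f_def)
    qed
    then obtain l where l: "n \<le> l" "l < m" "h l < 0" by auto
    have "h n > 0" using n \<open>c > 0\<close> by (simp add: h_def)
    then have "n < l" using l by (cases "n = l") auto
    have "l \<le> N" using l m by simp
    then obtain \<zeta> where "real n < \<zeta>" "\<zeta> < real l" "poly (newton_poly a N) \<zeta> = 0"
      using poly_IVT_neg[of "real n" "real l" "newton_poly a N"] h_eq[of n N] h_eq[of l N]
        \<open>h n > 0\<close> \<open>n < l\<close> \<open>h l < 0\<close> by auto
    then show "\<exists>\<zeta>\<in>{\<zeta>\<in>{0..real N}. poly (newton_poly a N) \<zeta> = 0}. real n < \<zeta> \<and> \<zeta> < real m"
      using l m by (intro bexI[of _ \<zeta>]) auto
  qed (use \<open>K > 0\<close> in auto)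
  show ?thesis
  proof (rule upper_density_nonpos)
    fix \<epsilon> :: real assume "\<epsilon> > 0"
    \<comment> \<open>Half of \<open>\<epsilon>\<close> pays for the zeros, the other half for the additional \<open>1\<close> in the count.\<close>
    define \<delta> where "\<delta> = \<epsilon> / (2 * real K)"
    have "\<delta> > 0" using \<open>\<epsilon> > 0\<close> \<open>K > 0\<close> by (simp add: \<delta>_def)
    have "h n\<^sub>0 \<noteq> 0" using n0 \<open>c > 0\<close> by (simp add: h_def)
    have "\<forall>\<^sub>F N in sequentially.
        real (card {\<zeta>\<in>{0..real N}. poly (newton_poly a N) \<zeta> = 0}) \<le> \<delta> * real N"
      by (rule newton_poly_few_zeros[OF growth \<open>h n\<^sub>0 \<noteq> 0\<close> h_eq \<open>\<delta> > 0\<close>])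
    moreover have "\<forall>\<^sub>F N in sequentially. 1 \<le> \<delta> * real N"
      using \<open>\<delta> > 0\<close> by real_asymp
    ultimately show "\<forall>\<^sub>F N in sequentially. real (card {m\<in>?A. m \<le> N}) \<le> \<epsilon> * real N"
      using eventually_ge_at_top[of n\<^sub>0]
    proof eventually_elim
      case (elim N)
      have "real (card {m\<in>?A. m \<le> N})
          \<le> real K * (real (card {\<zeta>\<in>{0..real N}. poly (newton_poly a N) \<zeta> = 0}) + 1)"
        using of_nat_mono[OF count[OF elim(3)], where ?'a = real]
        by (simp only: of_nat_mult of_nat_add of_nat_1)
      also have "\<dots> \<le> real K * (2 * \<delta> * real N)"
        using elim by (intro mult_left_mono) auto
      also have "\<dots> = \<epsilon> * real N" using \<open>K > 0\<close> by (simp add: \<delta>_def)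
      finally show ?case .
    qed
  qed
qed

section \<open>The operator is not frequently hypercyclic\<close>

theorem theorem1p1:
  fixes smul :: "'k::real_or_complex \<Rightarrow> 'x::banach \<Rightarrow> 'x"
    and T :: "'x \<Rightarrow> 'x"
  assumes "normed_space_over smul"
    and "separable_space (euclidean :: 'x topology)"
    and "infinite_dimensional smul"
    and "Vector_Spaces.linear smul smul T"
    and "bounded_linear T"
    and "(\<lambda>n. root n (onorm (T ^^ n))) \<longlonglongrightarrow> 0"
  shows "\<not> u_frequently_hypercyclic (\<lambda>x. x + T x) \<and> \<not> frequently_hypercyclic (\<lambda>x. x + T x)"
proof -
  define S where "S = (\<lambda>y. y + T y)"
  interpret T: bounded_linear T by fact
  interpret V: vector_space smul using assms(1) by (simp add: normed_space_over_def)
  have "\<exists>U. open U \<and> U \<noteq> {} \<and> upper_density {n. n \<ge> 1 \<and> (S ^^ n) x \<in> U} \<le> 0" for x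
  proof (cases "\<exists>y. T y \<noteq> 0")
    case True
    then obtain y where "T y \<noteq> 0" by blast
    then obtain g :: "'x \<Rightarrow> real" where g: "bounded_linear g" and "g (T y) > 0"
      using hahn_banach_positive_functional by blast
    interpret g: bounded_linear g by fact
    define y' where "y' = (1 / (\<bar>g y\<bar> + 1)) *\<^sub>R y"
    define c where "c = g (T y') / 2"
    have "\<bar>g y'\<bar> < 1" by (simp add: y'_def g.scaleR abs_mult)
    have "c > 0" using \<open>g (T y) > 0\<close> by (simp add: c_def y'_def g.scaleR T.scaleR add_nonneg_pos)
    define U where "U = {y. \<bar>g y\<bar> < 1 \<and> g (T y) > c}"
    have "open U" unfolding U_def
      by (intro open_Collect_conj open_Collect_less continuous_intros
          g.continuous_on T.continuous_on)
    moreover have "y' \<in> U" using \<open>\<bar>g y'\<bar> < 1\<close> \<open>c > 0\<close> by (simp add: U_def c_def)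
    moreover have "upper_density {n. n \<ge> 1 \<and> (S ^^ n) x \<in> U} \<le> 0"
    proof (rule order_trans[OF upper_density_mono])
      show "upper_density {n. \<bar>g ((S ^^ n) x)\<bar> < 1 \<and> g (T ((S ^^ n) x)) > c} \<le> 0"
        unfolding S_def by (rule upper_density_slab_hits[OF assms(5,6) g \<open>c > 0\<close>])
    qed (auto simp: U_def)
    ultimately show ?thesis by (intro exI[of _ U]) auto
  next
    \<comment> \<open>Here \<open>S\<close> is the identity, whose orbits miss the nonempty open set \<open>- {x}\<close>.\<close>
    case False
    then have fixed: "(S ^^ n) x = x" for n by (induction n) (auto simp: S_def)
    have "\<exists>z :: 'x. z \<noteq> 0"
    proof (rule ccontr)
      assume "\<not> (\<exists>z :: 'x. z \<noteq> 0)"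
      then have "V.span {} = (UNIV :: 'x set)" unfolding V.span_empty by blast
      then have "finite_dimensional_vector_space smul {}"
        by (intro finite_dimensional_vector_space.intro finite_dimensional_vector_space_axioms.intro
            V.vector_space_axioms V.independent_empty finite.emptyI)
      then show False using assms(3) unfolding infinite_dimensional_def by blast
    qed
    then obtain z :: 'x where "z \<noteq> 0" by blast
    then have "x + z \<in> - {x}" by simp
    then have "- {x} \<noteq> {}" by blast
    moreover have "upper_density {n. n \<ge> 1 \<and> (S ^^ n) x \<in> - {x}} \<le> 0"
      by (rule upper_density_nonpos) (simp add: fixed)
    ultimately show ?thesis by (intro exI[of _ "- {x}"] conjI open_Compl closed_singleton)
  qed
  then have "\<not> u_frequently_hypercyclic S"
    unfolding u_frequently_hypercyclic_def u_frequently_hypercyclic_vector_def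
    by (meson not_less)
  moreover have "u_frequently_hypercyclic S" if "frequently_hypercyclic S"
    using that lower_density_le_upper_density
    unfolding u_frequently_hypercyclic_def u_frequently_hypercyclic_vector_def
      frequently_hypercyclic_def frequently_hypercyclic_vector_def
    by (meson less_le_trans)
  ultimately show ?thesis by (auto simp: S_def)
qed

end
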